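(* Consider the following process on the cycle with $n\ge 3$ nodes $1,\dots,n$ (node $i$ adjacent to $i-1$ and $i+1$, indices modulo $n$). Each node $i$ carries a real load $x_i(t)$, and initially all loads are equal. At each step $t=0,1,2,\dots$, an edge $\{i,i+1\}$ is chosen uniformly at random among the $n$ cycle edges and a weight $w(t)$ is drawn from a fixed real distribution $W$ with finite second moment, independently of everything else; then $x_i(t+1)=x_{i+1}(t+1)=\frac{x_i(t)+x_{i+1}(t)+w(t)}{2}$, and all other loads are unchanged. Let $Gap(t)=\max_i x_i(t)-\min_i x_i(t)$. Then \[\lim_{t\to\infty}\mathbb{E}[Gap(t)^2]=\Omega\big(n\,\mathbb{E}[W^2]\big),\] i.e. the expected squared gap is, in the limit $t\to\infty$, bounded below by $c\,n\,\mathbb{E}[W^2]$ for an absolute constant $c>0$.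
   Context: The edge choice and the weight are independent across steps and independent of the current loads. *)

theory Defs
  imports "HOL-Probability.Probability"
begin

text \<open>
  The nodes of the cycle are \<open>0, \<dots>, n - 1\<close> (node \<open>n\<close> is called \<open>0\<close>), and edge \<open>i < n\<close> joins the
  nodes \<open>i\<close> and \<open>i + 1\<close> modulo \<open>n\<close>. Values of a load vector outside \<open>{..<n}\<close> are irrelevant.
\<close>

definition average_step :: "nat \<Rightarrow> nat \<times> real \<Rightarrow> (nat \<Rightarrow> real) \<Rightarrow> nat \<Rightarrow> real" where
  "average_step n s x =
     (let i = fst s; j = Suc i mod n; a = (x i + x j + snd s) / 2 in x(i := a, j := a))"

text \<open>
  A sample point \<open>\<omega>\<close> lists, for each time \<open>t\<close>, the pair \<open>\<omega> t\<close> of the chosen edge and the weight.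
\<close>

primrec loads :: "nat \<Rightarrow> real \<Rightarrow> (nat \<Rightarrow> nat \<times> real) \<Rightarrow> nat \<Rightarrow> nat \<Rightarrow> real" where
  "loads n x0 \<omega> 0 = (\<lambda>i. x0)"
| "loads n x0 \<omega> (Suc t) = average_step n (\<omega> t) (loads n x0 \<omega> t)"

definition gap :: "nat \<Rightarrow> (nat \<Rightarrow> real) \<Rightarrow> real" where
  "gap n x = Max (x ` {..<n}) - Min (x ` {..<n})"

text \<open>
  The canonical space of the process: being a product measure, it makes all edge choices and all
  weights mutually independent, the edges uniform and the weights distributed as \<open>W\<close>.
\<close>

definition process_space :: "nat \<Rightarrow> real measure \<Rightarrow> (nat \<Rightarrow> nat \<times> real) measure" where
  "process_space n W = (\<Pi>\<^sub>M t\<in>UNIV. measure_pmf (pmf_of_set {..<n}) \<Otimes>\<^sub>M W)"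

end

theory Submission
  imports Defs
begin

text \<open>
  Let \<open>S k\<close> be the sum over all nodes \<open>j\<close> of the squared load difference of \<open>j\<close> and \<open>j + k\<close>.
  Averaging over the chosen edge closes up on the \<open>S k\<close>: with \<open>s k\<close> the expectation of \<open>S k\<close> and
  \<open>v = E W\<^sup>2\<close>, the increment of \<open>n s k\<close> in one step is \<open>s (k - 1) - 2 s k + s (k + 1) - s 1 + n v\<close>
  for \<open>2 \<le> k \<le> n - 2\<close>, and \<open>s 2 - 5/2 s 1 + n v / 2\<close> for \<open>k = 1\<close>.

  The expectation of any convex functional that ignores additive constants is nondecreasing in time: the
  transition operator preserves this class of functionals, and averaging the first step over its edge
  only shifts the constant initial vector by a constant. This applies to \<open>S k\<close> and to the
  squared gap. Nonnegative increments in the recurrences, together with \<open>s (n - k) = s k\<close>, force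
  \<open>s 1 \<le> (n - 2) v\<close>, so everything is bounded and converges, and the limiting recurrence has
  the solution \<open>s k = v (k (n - k) - 1)\<close>. Finally \<open>n\<close> times the squared gap dominates \<open>S (n div 2)\<close>.
\<close>

section \<open>Squared load differences at a fixed offset, and index arithmetic modulo
  \<open>n\<close>\<close>

definition shift_dist :: "nat \<Rightarrow> nat \<Rightarrow> (nat \<Rightarrow> real) \<Rightarrow> real" where
  "shift_dist n k x = (\<Sum>j<n. (x j - x ((j + k) mod n))\<^sup>2)"

lemma sum_mod_shift:
  fixes f :: "nat \<Rightarrow> real"
  assumes "n > 0"
  shows "(\<Sum>j<n. f ((j + m) mod n)) = (\<Sum>j<n. f j)"
proof (induction m)
  case 0
  then show ?case by (intro sum.cong) auto
next
  case (Suc m)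
  obtain n' where n: "n = Suc n'" using assms by (cases n) auto
  have "(\<Sum>j<n. f ((j + Suc m) mod n)) = (\<Sum>j<n'. f ((Suc j + m) mod n)) + f ((n + m) mod n)"
    by (simp add: n)
  also have "\<dots> = (\<Sum>j<n. f ((j + m) mod n))"
    using mod_add_self1[of n m] unfolding n sum.lessThan_Suc_shift by simp
  finally show ?case using Suc by simp
qed

text \<open>Solves the condition for \<open>j\<close> to be the right end of edge \<open>i\<close>
  for \<open>i\<close>, so that a sum over edges can single out that edge. Adding
  \<open>n - 1\<close> stands for subtracting 1 modulo \<open>n\<close> and avoids truncated
  subtraction.\<close>

lemma pred_mod_iff:
  fixes i j n :: nat
  assumes "i < n" "j < n"
  shows "j = Suc i mod n \<longleftrightarrow> i = (j + (n - 1)) mod n"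
proof (cases "j = 0")
  case True
  then show ?thesis using assms by (cases "Suc i = n") auto
next
  case False
  then have "(j + (n - 1)) mod n = j - 1" using assms
    using mod_add_self2[of "j - 1" n] by simp
  then show ?thesis using assms False by (cases "Suc i = n") auto
qed

text \<open>Two offsets below \<open>n\<close> differ by less than \<open>n\<close>, so
  \<open>n\<close> divides the difference only if it is 0. This later keeps apart the edges that
  touch two given nodes.\<close>

lemma add_mod_eq_iff:
  fixes a b j n :: nat
  assumes "a < n" "b < n"
  shows "(j + a) mod n = (j + b) mod n \<longleftrightarrow> a = b"
  using assms mod_eq_dvd_iff_nat[of "j + a" "j + b" n] mod_eq_dvd_iff_nat[of "j + b" "j + a" n]
  by (cases a b rule: linorder_cases) (auto dest!: dvd_imp_le)

lemma average_step_apply: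
  "average_step n (i, w) x j =
     (if j = i \<or> j = Suc i mod n then (x i + x (Suc i mod n) + w) / 2 else x j)"
  by (auto simp: average_step_def Let_def)

section \<open>One-step identities, summed over the chosen edge\<close>

context
  fixes n :: nat and x :: "nat \<Rightarrow> real"
  assumes n: "n \<ge> 3"
begin

text \<open>\<open>X\<close> is the periodic extension of the loads, so shifted indices need no
  reduction. \<open>A\<close> has two free offsets because \<open>sum_average\<close> produces its
  terms in that form; \<open>A_shift\<close>, \<open>A_commute\<close> and \<open>A_n\<close> bring
  them back to \<open>A 0 k\<close>, which is \<open>shift_dist n k x\<close>.\<close>

private definition X :: "nat \<Rightarrow> real" where "X m = x (m mod n)"
private definition A :: "nat \<Rightarrow> nat \<Rightarrow> real" where "A a c = (\<Sum>j<n. (X (j + a) - X (j + c))\<^sup>2)"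

private lemma X_less: "j < n \<Longrightarrow> x j = X j" by (simp add: X_def)
private lemma X_mod: "X (m mod n) = X m" by (simp add: X_def)
private lemma X_n: "X (n + m) = X m" "X (m + n) = X m" by (simp_all add: X_def)

private lemma sum_X: "(\<Sum>j<n. X (j + a)) = (\<Sum>j<n. X j)"
  using sum_mod_shift[of n X a] n by (simp add: X_mod)

private lemma A_commute: "A a c = A c a"
  by (simp add: A_def power2_commute)

private lemma A_shift: "A (a + m) (c + m) = A a c"
proof -
  have "A a c = (\<Sum>j<n. (\<lambda>j. (X (j + a) - X (j + c))\<^sup>2) ((j + m) mod n))"
    unfolding A_def using n by (intro sum_mod_shift[symmetric]) auto
  also have "\<dots> = A (a + m) (c + m)"
    unfolding A_def X_def by (simp add: mod_simps ac_simps)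
  finally show ?thesis by simp
qed

private lemma A_n: "A (n + a) c = A a c" "A n c = A 0 c"
  by (simp_all add: A_def X_n add.left_commute[of _ n])

private lemma shift_dist_A: "shift_dist n k x = A 0 k"
  unfolding shift_dist_def A_def by (intro sum.cong) (auto simp: X_def)

text \<open>The squared distance to a midpoint is the mean of the two squared distances minus a
  quarter of the squared length of the segment. The part linear in \<open>w\<close> cancels in the
  sum over \<open>j\<close>, as all translates of \<open>X\<close> have the same sum; only
  \<open>w\<^sup>2\<close> survives.\<close>

private lemma sum_average:
  "(\<Sum>j<n. ((X (j + a) + X (j + a + 1) + w) / 2 - X (j + c))\<^sup>2) =
     A a c / 2 + A (a + 1) c / 2 - A 0 1 / 4 + real n * w\<^sup>2 / 4"
proof -
  have "((X (j + a) + X (j + a + 1) + w) / 2 - X (j + c))\<^sup>2 =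
      (X (j + a) - X (j + c))\<^sup>2 / 2 + (X (j + (a + 1)) - X (j + c))\<^sup>2 / 2
      - (X (j + a) - X (j + (a + 1)))\<^sup>2 / 4 + w\<^sup>2 / 4
      + w / 2 * (X (j + a) + X (j + (a + 1)) - 2 * X (j + c))" for j
    by (simp add: power2_eq_square field_simps)
  then have "(\<Sum>j<n. ((X (j + a) + X (j + a + 1) + w) / 2 - X (j + c))\<^sup>2) =
      A a c / 2 + A (a + 1) c / 2 - A a (a + 1) / 4 + real n * w\<^sup>2 / 4
      + w / 2 * ((\<Sum>j<n. X (j + a)) + (\<Sum>j<n. X (j + (a + 1))) - 2 * (\<Sum>j<n. X (j + c)))"
    unfolding A_def
    by (simp only: sum.distrib sum_subtractf sum_divide_distrib[symmetric] sum_distrib_left[symmetric]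
        sum_constant card_lessThan)
  also have "A a (a + 1) = A 0 1" using A_shift[of 0 a 1] by (simp add: add.commute)
  finally show ?thesis unfolding sum_X by simp
qed

private lemma step_X:
  assumes "i < n" "j < n"
  shows "average_step n (i, w) x j =
    (if i = j then (X j + X (j + 1) + w) / 2
     else if i = (j + (n - 1)) mod n then (X (j + (n - 1)) + X (j + (n - 1) + 1) + w) / 2 else X j)"
  using assms n by (auto simp: average_step_apply pred_mod_iff X_def mod_simps)

private lemma X_pred: "X (j + (n - 1) + 1) = X j"
  using n by (simp add: X_def)

text \<open>Three edges touch \<open>j\<close> or \<open>j + 1\<close>: the common one, which
  equalises the two loads, and one on either side, giving \<open>?T2\<close> and \<open>?T3\<close>.
  Each term stands on the side where its coefficient is nonnegative, as \<open>integral_step\<close>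
  requires.\<close>

lemma sum_step_shift_dist_1:
  "(\<Sum>i<n. shift_dist n 1 (average_step n (i, w) x)) + 5 / 2 * shift_dist n 1 x =
     real n * shift_dist n 1 x + shift_dist n 2 x + real n * w\<^sup>2 / 2"
proof -
  let ?T2 = "\<lambda>j. ((X (j + (n - 1)) + X (j + (n - 1) + 1) + w) / 2 - X (j + 1))\<^sup>2"
  let ?T3 = "\<lambda>j. ((X (j + 1) + X (j + 1 + 1) + w) / 2 - X (j + 0))\<^sup>2"
  let ?D = "\<lambda>j. (X (j + 0) - X (j + 1))\<^sup>2"
  have inner: "(\<Sum>i<n. (average_step n (i, w) x j - average_step n (i, w) x ((j + 1) mod n))\<^sup>2) =
      (real n - 3) * ?D j + ?T2 j + ?T3 j" if j: "j < n" for j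
  proof -
    let ?p2 = "(j + (n - 1)) mod n" and ?p3 = "(j + 1) mod n"
    have lt: "?p2 < n" "?p3 < n" using n by auto
    have d: "?p2 \<noteq> j" "?p3 \<noteq> j" "?p2 \<noteq> ?p3"
      using add_mod_eq_iff[of "n - 1" n 0 j] add_mod_eq_iff[of 1 n 0 j] add_mod_eq_iff[of "n - 1" n 1 j] j n
      by auto
    have "(?p3 + (n - 1)) mod n = (j + n) mod n"
      unfolding mod_add_left_eq using n by simp
    then have p: "(?p3 + (n - 1)) mod n = j" using j by simp
    have Xp: "X (?p3 + (n - 1)) = X j" "X (?p3 + 1) = X (j + 1 + 1)"
      using p by (metis X_mod) (simp add: X_def mod_simps)
    \<comment> \<open>The value for an untouched pair plus one correction per affected edge, so that
      the sum over \<open>i\<close> collapses. For \<open>i = j\<close> both ends receive the same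
      load and the difference becomes 0, whence the correction \<open>- ?D j\<close>.\<close>
    have "(average_step n (i, w) x j - average_step n (i, w) x ?p3)\<^sup>2 =
        ?D j + (if i = j then - ?D j else 0) + (if i = ?p2 then ?T2 j - ?D j else 0)
        + (if i = ?p3 then ?T3 j - ?D j else 0)" if i: "i < n" for i
      using d unfolding step_X[OF i j] step_X[OF i lt(2)] p X_pred Xp X_mod
      by (auto simp: power2_commute)
    then show ?thesis using lt j
      by (simp add: sum.distrib algebra_simps)
  qed
  have "(\<Sum>i<n. shift_dist n 1 (average_step n (i, w) x)) =
      (\<Sum>j<n. \<Sum>i<n. (average_step n (i, w) x j - average_step n (i, w) x ((j + 1) mod n))\<^sup>2)"
    unfolding shift_dist_def by (rule sum.swap)
  also have "\<dots> = (\<Sum>j<n. (real n - 3) * ?D j + ?T2 j + ?T3 j)"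
    by (intro sum.cong refl inner) auto
  also have "\<dots> = (real n - 3) * A 0 1 + (\<Sum>j<n. ?T2 j) + (\<Sum>j<n. ?T3 j)"
    unfolding A_def by (simp only: sum.distrib sum_distrib_left)
  also have "\<dots> = (real n - 3) * A 0 1 + (A (n - 1) 1 + A n 1 + A 1 0 + A 2 0 - A 0 1 + real n * w\<^sup>2) / 2"
    unfolding sum_average using n by (simp add: field_simps numeral_2_eq_2)
  also have "A (n - 1) 1 = A 0 2"
    using A_shift[of "n - 1" 1 1] A_n(2)[of 2] n by (simp add: numeral_2_eq_2)
  finally show ?thesis
    by (simp add: shift_dist_A A_n A_commute[of "Suc 0" 0] A_commute[of 2 0] field_simps)
qed

text \<open>For these \<open>k\<close> the nodes \<open>j\<close> and \<open>j + k\<close> are not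
  adjacent, so four distinct edges move exactly one of them each, and every other edge leaves the
  pair alone.\<close>

lemma sum_step_shift_dist:
  assumes k: "2 \<le> k" "k \<le> n - 2"
  shows "(\<Sum>i<n. shift_dist n k (average_step n (i, w) x)) + shift_dist n 1 x =
     (real n - 2) * shift_dist n k x + shift_dist n (k - 1) x + shift_dist n (k + 1) x + real n * w\<^sup>2"
proof -
  let ?T1 = "\<lambda>j. ((X (j + 0) + X (j + 0 + 1) + w) / 2 - X (j + k))\<^sup>2"
  let ?T2 = "\<lambda>j. ((X (j + (n - 1)) + X (j + (n - 1) + 1) + w) / 2 - X (j + k))\<^sup>2"
  let ?T3 = "\<lambda>j. ((X (j + k) + X (j + k + 1) + w) / 2 - X (j + 0))\<^sup>2"
  let ?T4 = "\<lambda>j. ((X (j + (k - 1)) + X (j + (k - 1) + 1) + w) / 2 - X (j + 0))\<^sup>2"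
  let ?D = "\<lambda>j. (X (j + 0) - X (j + k))\<^sup>2"
  have inner: "(\<Sum>i<n. (average_step n (i, w) x j - average_step n (i, w) x ((j + k) mod n))\<^sup>2) =
      (real n - 4) * ?D j + ?T1 j + ?T2 j + ?T3 j + ?T4 j" if j: "j < n" for j
  proof -
    let ?p2 = "(j + (n - 1)) mod n" and ?p3 = "(j + k) mod n" and ?p4 = "(j + (k - 1)) mod n"
    \<comment> \<open>The four relevant edges have offsets \<open>0\<close>, \<open>n - 1\<close>,
      \<open>k\<close> and \<open>k - 1\<close> from \<open>j\<close>; both bounds on
      \<open>k\<close> enter in showing them pairwise distinct.\<close>
    have lt: "?p2 < n" "?p3 < n" "?p4 < n" using n by auto
    have d: "?p2 \<noteq> j" "?p3 \<noteq> j" "?p4 \<noteq> j" "?p2 \<noteq> ?p3" "?p2 \<noteq> ?p4" "?p3 \<noteq> ?p4"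
      using add_mod_eq_iff[of "n - 1" n 0 j] add_mod_eq_iff[of k n 0 j] add_mod_eq_iff[of "k - 1" n 0 j]
        add_mod_eq_iff[of "n - 1" n k j] add_mod_eq_iff[of "n - 1" n "k - 1" j]
        add_mod_eq_iff[of k n "k - 1" j] j n k
      by auto
    have "(?p3 + (n - 1)) mod n = (j + (k - 1) + n) mod n"
      unfolding mod_add_left_eq using k n by simp
    then have p: "(?p3 + (n - 1)) mod n = ?p4" by simp
    have Xp: "X (?p3 + (n - 1)) = X (j + (k - 1))"
      using p by (metis X_mod)
    have Xk: "X (j + (k - 1) + 1) = X (j + k)" "X (?p3 + 1) = X (j + k + 1)"
      using k by (simp_all add: X_def mod_simps)
    have "(average_step n (i, w) x j - average_step n (i, w) x ?p3)\<^sup>2 =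
        ?D j + (if i = j then ?T1 j - ?D j else 0) + (if i = ?p2 then ?T2 j - ?D j else 0)
        + (if i = ?p3 then ?T3 j - ?D j else 0) + (if i = ?p4 then ?T4 j - ?D j else 0)" if i: "i < n" for i
      using d unfolding step_X[OF i j] step_X[OF i lt(2)] p X_pred Xp Xk X_mod
      by (auto simp: power2_commute)
    then show ?thesis using lt j
      by (simp add: sum.distrib algebra_simps)
  qed
  have "(\<Sum>i<n. shift_dist n k (average_step n (i, w) x)) =
      (\<Sum>j<n. \<Sum>i<n. (average_step n (i, w) x j - average_step n (i, w) x ((j + k) mod n))\<^sup>2)"
    unfolding shift_dist_def by (rule sum.swap)
  also have "\<dots> = (\<Sum>j<n. (real n - 4) * ?D j + ?T1 j + ?T2 j + ?T3 j + ?T4 j)"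
    by (intro sum.cong refl inner) auto
  also have "\<dots> = (real n - 4) * A 0 k + (\<Sum>j<n. ?T1 j) + (\<Sum>j<n. ?T2 j) + (\<Sum>j<n. ?T3 j) + (\<Sum>j<n. ?T4 j)"
    unfolding A_def by (simp only: sum.distrib sum_distrib_left)
  also have "\<dots> = (real n - 4) * A 0 k + (A 0 k + A 1 k + A (n - 1) k + A n k + A k 0 + A (k + 1) 0
      + A (k - 1) 0 + A k 0) / 2 - A 0 1 + real n * w\<^sup>2"
    unfolding sum_average using n k by (simp add: field_simps)
  also have "A (n - 1) k = A 0 (k + 1)"
    using A_shift[of "n - 1" 1 k] A_n(2)[of "k + 1"] n by simp
  also have "A 1 k = A 0 (k - 1)"
    using A_shift[of 0 1 "k - 1"] k by simp
  finally show ?thesis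
    by (simp add: shift_dist_A A_n A_commute[of k 0] A_commute[of "Suc k" 0] A_commute[of "k - Suc 0" 0] field_simps)
qed

text \<open>A pair at offset \<open>k\<close>, seen from its other end, is a pair at offset
  \<open>n - k\<close>.\<close>

lemma shift_dist_reflect:
  assumes "k \<le> n"
  shows "shift_dist n (n - k) x = shift_dist n k x"
  using A_shift[of 0 k "n - k"] A_n(2)[of k] A_commute[of k n] assms by (simp add: shift_dist_A)

lemma shift_dist_Suc_le: "shift_dist n (Suc k) x \<le> 2 * shift_dist n k x + 2 * shift_dist n 1 x"
proof -
  have "(X (j + 0) - X (j + Suc k))\<^sup>2 \<le> 2 * (X (j + 0) - X (j + k))\<^sup>2 + 2 * (X (j + k) - X (j + Suc k))\<^sup>2" for j
    using zero_le_power2[of "X j - X (j + k) - (X (j + k) - X (j + Suc k))"]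
    by (simp add: power2_eq_square algebra_simps)
  then have "A 0 (Suc k) \<le> 2 * A 0 k + 2 * A k (Suc k)"
    unfolding A_def sum_distrib_left sum.distrib[symmetric] by (intro sum_mono)
  then show ?thesis using A_shift[of 0 k 1] by (simp add: shift_dist_A)
qed

text \<open>The factor is crude but does not depend on time: it carries integrability and
  boundedness from offset 1 to all offsets.\<close>

lemma shift_dist_le: "shift_dist n k x \<le> 4 ^ k * shift_dist n 1 x"
proof (induction k)
  case 0
  then show ?case by (simp add: shift_dist_def sum_nonneg)
next
  case (Suc k)
  have "0 \<le> shift_dist n 1 x" by (simp add: shift_dist_def sum_nonneg)
  then have "2 * shift_dist n 1 x \<le> 2 * 4 ^ k * shift_dist n 1 x"
    by (intro mult_right_mono) auto
  then show ?case using Suc shift_dist_Suc_le[of k] by simp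
qed

text \<open>Exactly two edges contain node \<open>j\<close>, and each of them raises a constant load
  by \<open>w / 2\<close>. Hence the average over the edge is again a constant vector, the starting
  point of \<open>expect_mono_Suc\<close>.\<close>

lemma sum_step_const: 
  assumes "j < n"
  shows "(\<Sum>i<n. average_step n (i, w) (\<lambda>_. c) j) = real n * (c + w / real n)"
proof -
  let ?p2 = "(j + (n - 1)) mod n"
  have d: "?p2 \<noteq> j"
    using add_mod_eq_iff[of "n - 1" n 0 j] assms n by auto
  have "average_step n (i, w) (\<lambda>_. c) j = c + (if i = j then w / 2 else 0) + (if i = ?p2 then w / 2 else 0)"
    if "i < n" for i
    using that assms d by (auto simp: average_step_apply pred_mod_iff field_simps)
  then show ?thesis using assms n by (simp add: sum.distrib field_simps)
qed

end

section \<open>Measurability of the process and its transition operator\<close>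

abbreviation load_space :: "(nat \<Rightarrow> real) measure" where
  "load_space \<equiv> \<Pi>\<^sub>M i\<in>UNIV. borel"

lemma space_load_space [simp]: "space load_space = UNIV"
  by (simp add: space_PiM)

lemma measurable_average_step [measurable (raw)]:
  assumes f[measurable]: "f \<in> N \<rightarrow>\<^sub>M load_space" and g[measurable]: "g \<in> borel_measurable N"
  shows "(\<lambda>z. average_step n (i, g z) (f z)) \<in> N \<rightarrow>\<^sub>M load_space"
proof (rule measurable_PiM_single')
  fix j
  show "(\<lambda>z. average_step n (i, g z) (f z) j) \<in> borel_measurable N"
    unfolding average_step_apply by measurable
qed auto

lemma measurable_average_step_random [measurable]:
  assumes e: "e \<in> N \<rightarrow>\<^sub>M measure_pmf p \<Otimes>\<^sub>M borel" and f: "f \<in> N \<rightarrow>\<^sub>M load_space"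
  shows "(\<lambda>z. average_step n (e z) (f z)) \<in> N \<rightarrow>\<^sub>M load_space"
proof -
  have m: "(\<lambda>z. fst (e z)) \<in> N \<rightarrow>\<^sub>M count_space UNIV" "(\<lambda>z. snd (e z)) \<in> borel_measurable N"
    using measurable_compose[OF e measurable_fst] measurable_compose[OF e measurable_snd] 
    by auto
  \<comment> \<open>The edge ranges over a countable set, so measurability may be checked for each
    fixed edge.\<close>
  have "(\<lambda>z. average_step n (fst (e z), snd (e z)) (f z)) \<in> N \<rightarrow>\<^sub>M load_space"
    by (rule measurable_compose_countable[OF _ m(1)]) (rule measurable_average_step[OF f m(2)])
  then show ?thesis by simp
qed

locale cycle_averaging = W: real_distribution W for W :: "real measure" +
  fixes n :: nat
  assumes n_ge_3: "n \<ge> 3"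
begin

abbreviation M where "M \<equiv> measure_pmf (pmf_of_set {..<n}) \<Otimes>\<^sub>M W"

lemma sets_W [measurable_cong]: "sets W = sets borel" 
  by simp

lemma emeasure_W_UNIV: "emeasure W UNIV = 1"
  using W.emeasure_space_1 by simp

sublocale M: prob_space M
  by (intro prob_space_pair measure_pmf.prob_space_axioms W.prob_space_axioms)

sublocale S: sequence_space M
  by unfold_locales

lemma process_space_eq: "process_space n W = S.S"
  by (simp add: process_space_def)

lemma measurable_loads [measurable]:
  "(\<lambda>\<omega>. loads n x0 \<omega> t) \<in> S.S \<rightarrow>\<^sub>M load_space"
proof (induction t)
  case 0
  then show ?case by (simp add: measurable_const)
next
  case (Suc t)
  have "(\<lambda>\<omega>. \<omega> t) \<in> S.S \<rightarrow>\<^sub>M M" by measurable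
  also have "S.S \<rightarrow>\<^sub>M M = S.S \<rightarrow>\<^sub>M measure_pmf (pmf_of_set {..<n}) \<Otimes>\<^sub>M borel"
    by (intro measurable_cong_sets sets_pair_measure_cong refl) simp
  finally show ?case
    using Suc by (simp add: measurable_average_step_random)
qed

text \<open>The one-step Markov operator on functionals. Values in \<open>ennreal\<close> let it be
  iterated before any integrability is known.\<close>

definition trans_op :: "((nat \<Rightarrow> real) \<Rightarrow> ennreal) \<Rightarrow> (nat \<Rightarrow> real) \<Rightarrow> ennreal" where
  "trans_op F x = (\<Sum>i<n. \<integral>\<^sup>+w. F (average_step n (i, w) x) \<partial>W) / of_nat n"

definition expect :: "real \<Rightarrow> nat \<Rightarrow> ((nat \<Rightarrow> real) \<Rightarrow> ennreal) \<Rightarrow> ennreal" where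
  "expect x0 t F = (\<integral>\<^sup>+\<omega>. F (loads n x0 \<omega> t) \<partial>process_space n W)"

lemma measurable_trans_op [measurable]:
  assumes [measurable]: "F \<in> borel_measurable load_space"
  shows "trans_op F \<in> borel_measurable load_space"
proof -
  have [measurable]: "(\<lambda>(x, w). F (average_step n (i, w) x)) \<in> borel_measurable (load_space \<Otimes>\<^sub>M W)" for i
    by measurable
  show ?thesis unfolding trans_op_def by measurable
qed

lemma measurable_section:
  assumes "F \<in> borel_measurable load_space"
  shows "(\<lambda>w. F (average_step n (i, w) x)) \<in> borel_measurable W"
proof (rule measurable_compose[OF _ assms])
  show "(\<lambda>w. average_step n (i, w) x) \<in> W \<rightarrow>\<^sub>M load_space"
    by (rule measurable_average_step) (auto intro: measurable_const)
qed

lemma loads_cong: "(\<And>s. s < t \<Longrightarrow> \<omega> s = \<omega>' s) \<Longrightarrow> loads n x0 \<omega> t = loads n x0 \<omega>' t"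
  by (induction t) auto

text \<open>The Markov property: the loads at time \<open>t\<close> depend only on earlier steps,
  hence are independent of step \<open>t\<close>.\<close>

lemma expect_Suc:
  assumes F[measurable]: "F \<in> borel_measurable load_space"
  shows "expect x0 (Suc t) F = expect x0 t (trans_op F)"
proof -
  have cong: "sets M = sets (measure_pmf (pmf_of_set {..<n}) \<Otimes>\<^sub>M borel)"
    by (intro sets_pair_measure_cong refl) simp
  have [measurable]: "(\<lambda>(\<omega>, s). average_step n s (loads n x0 \<omega> t)) \<in> S.S \<Otimes>\<^sub>M M \<rightarrow>\<^sub>M load_space"
    unfolding split_beta
    by (rule measurable_average_step_random) (auto simp: measurable_cong_sets[OF refl cong, symmetric])
  have comb: "loads n x0 (comb_seq t \<omega> \<omega>') (Suc t) = average_step n (\<omega>' 0) (loads n x0 \<omega> t)" for \<omega> \<omega>'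
    using loads_cong[of t "comb_seq t \<omega> \<omega>'" \<omega>] by (simp add: comb_seq_def)
  have step: "(\<integral>\<^sup>+s. F (average_step n s x) \<partial>M) = trans_op F x" for x
  proof -
    have [measurable]: "(\<lambda>s. average_step n s x) \<in> M \<rightarrow>\<^sub>M load_space"
      by (rule measurable_average_step_random)
        (auto simp: measurable_cong_sets[OF refl cong, symmetric] intro!: measurable_const)
    have "(\<integral>\<^sup>+s. F (average_step n s x) \<partial>M) =
        (\<integral>\<^sup>+i. \<integral>\<^sup>+w. F (average_step n (i, w) x) \<partial>W \<partial>measure_pmf (pmf_of_set {..<n}))"
      by (subst W.nn_integral_fst[symmetric]) auto
    also have "\<dots> = trans_op F x"
      using n_ge_3 unfolding trans_op_def by (subst nn_integral_pmf_of_set) (auto simp: lessThan_empty_iff)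
    finally show ?thesis .
  qed
  \<comment> \<open>Splicing two independent samples at time \<open>t\<close> reproduces the product
    measure. The first supplies the steps before \<open>t\<close> and entry 0 of the second becomes
    step \<open>t\<close>, so past and present are separate integration variables.\<close>
  have "expect x0 (Suc t) F =
      (\<integral>\<^sup>+z. F (loads n x0 z (Suc t)) \<partial>distr (S.S \<Otimes>\<^sub>M S.S) S.S (\<lambda>(\<omega>, \<omega>'). comb_seq t \<omega> \<omega>'))"
    unfolding S.PiM_comb_seq expect_def process_space_eq ..
  also have "\<dots> = (\<integral>\<^sup>+z. F (loads n x0 (comb_seq t (fst z) (snd z)) (Suc t)) \<partial>(S.S \<Otimes>\<^sub>M S.S))"
    by (subst nn_integral_distr[OF measurable_comb_seq])
      (auto simp: split_beta intro!: measurable_compose[OF measurable_loads F])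
  also have "\<dots> = (\<integral>\<^sup>+z. F (average_step n (snd z 0) (loads n x0 (fst z) t)) \<partial>(S.S \<Otimes>\<^sub>M S.S))"
    unfolding comb ..
  also have "\<dots> = (\<integral>\<^sup>+\<omega>. \<integral>\<^sup>+\<omega>'. F (average_step n (\<omega>' 0) (loads n x0 \<omega> t)) \<partial>S.S \<partial>S.S)"
    by (subst S.P.nn_integral_fst[symmetric]) auto
  also have "\<dots> = (\<integral>\<^sup>+\<omega>. \<integral>\<^sup>+s. F (average_step n s (loads n x0 \<omega> t)) \<partial>distr S.S M (\<lambda>\<omega>'. \<omega>' 0) \<partial>S.S)"
    by (intro nn_integral_cong, subst nn_integral_distr) auto
  also have "distr S.S M (\<lambda>\<omega>'. \<omega>' 0) = M"
    by (rule S.PiM_component) simp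
  finally show ?thesis
    by (simp add: step expect_def process_space_eq)
qed

text \<open>Steps are peeled off from the last one backwards, so the outermost application of
  \<open>trans_op\<close> acts as the first step of the process.\<close>

lemma expect_eq_funpow:
  assumes "F \<in> borel_measurable load_space"
  shows "expect x0 t F = (trans_op ^^ t) F (\<lambda>_. x0)"
  using assms
proof (induction t arbitrary: F)
  case 0
  then show ?case by (simp add: expect_def process_space_eq S.P.emeasure_space_1)
next
  case (Suc t)
  then show ?case by (simp add: expect_Suc measurable_trans_op funpow_swap1)
qed

section \<open>Convex shift-invariant functionals and monotonicity in time\<close>

text \<open>Convexity (take \<open>d = 0\<close>) together with invariance under adding constants (take all \<open>y i\<close> equal).\<close>

definition jensen_invariant :: "((nat \<Rightarrow> real) \<Rightarrow> ennreal) \<Rightarrow> bool" where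
  "jensen_invariant F \<longleftrightarrow> (\<forall>x y d. (\<forall>j<n. (\<Sum>i<n. y i j) = real n * (x j + d)) \<longrightarrow>
     of_nat n * F x \<le> (\<Sum>i<n. F (y i)))"

lemma jensen_invariantD:
  "jensen_invariant F \<Longrightarrow> (\<And>j. j < n \<Longrightarrow> (\<Sum>i<n. y i j) = real n * (x j + d)) \<Longrightarrow>
    of_nat n * F x \<le> (\<Sum>i<n. F (y i))"
  unfolding jensen_invariant_def by blast

text \<open>For a fixed edge and weight the averaging step is affine in the loads and commutes with
  adding a constant, so the hypothesis on \<open>x\<close>, \<open>y\<close> and \<open>d\<close>
  survives it. The resulting inequality is then integrated over the weight and summed over the
  edges.\<close>

lemma jensen_invariant_trans_op:
  assumes [measurable]: "F \<in> borel_measurable load_space" and F: "jensen_invariant F"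
  shows "jensen_invariant (trans_op F)"
  unfolding jensen_invariant_def
proof (intro allI impI)
  fix x :: "nat \<Rightarrow> real" and y :: "nat \<Rightarrow> nat \<Rightarrow> real" and d :: real
  assume y: "\<forall>j<n. (\<Sum>i<n. y i j) = real n * (x j + d)"
  have [measurable]: "(\<lambda>w. F (average_step n (e, w) z)) \<in> borel_measurable W" for e z
    by (rule measurable_section) fact
  have "of_nat n * (\<integral>\<^sup>+w. F (average_step n (e, w) x) \<partial>W) \<le>
      (\<Sum>i<n. \<integral>\<^sup>+w. F (average_step n (e, w) (y i)) \<partial>W)" if e: "e < n" for e
  proof -
    have "of_nat n * F (average_step n (e, w) x) \<le> (\<Sum>i<n. F (average_step n (e, w) (y i)))" for w
    proof -
      have "(\<Sum>i<n. average_step n (e, w) (y i) j) = real n * (average_step n (e, w) x j + d)" if "j < n" for j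
        using y e that n_ge_3
        by (auto simp: average_step_apply sum.distrib sum_divide_distrib[symmetric] field_simps)
      then show ?thesis by (intro jensen_invariantD[OF F]) auto
    qed
    then have "(\<integral>\<^sup>+w. of_nat n * F (average_step n (e, w) x) \<partial>W) \<le>
        (\<integral>\<^sup>+w. (\<Sum>i<n. F (average_step n (e, w) (y i))) \<partial>W)"
      by (intro nn_integral_mono)
    then show ?thesis by (simp add: nn_integral_cmult nn_integral_sum)
  qed
  then have "(\<Sum>e<n. of_nat n * (\<integral>\<^sup>+w. F (average_step n (e, w) x) \<partial>W)) \<le>
      (\<Sum>e<n. \<Sum>i<n. \<integral>\<^sup>+w. F (average_step n (e, w) (y i)) \<partial>W)"
    by (intro sum_mono) auto
  also have "\<dots> = (\<Sum>i<n. \<Sum>e<n. \<integral>\<^sup>+w. F (average_step n (e, w) (y i)) \<partial>W)"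
    by (rule sum.swap)
  finally show "of_nat n * trans_op F x \<le> (\<Sum>i<n. trans_op F (y i))"
    unfolding trans_op_def divide_ennreal_def sum_distrib_left[symmetric] sum_distrib_right[symmetric]
      mult.assoc[symmetric]
    by (rule mult_right_mono) simp
qed

lemma expect_mono_Suc:
  assumes F: "F \<in> borel_measurable load_space" "jensen_invariant F"
  shows "expect x0 t F \<le> expect x0 (Suc t) F"
proof -
  define G where "G = (trans_op ^^ t) F"
  have G: "G \<in> borel_measurable load_space \<and> jensen_invariant G"
    unfolding G_def by (induction t) (auto simp: F measurable_trans_op jensen_invariant_trans_op)
  then have [measurable]: "(\<lambda>w. G (average_step n (e, w) (\<lambda>_. x0))) \<in> borel_measurable W" for e
    by (intro measurable_section) auto
  have n0: "of_nat n \<noteq> (0::ennreal)" using n_ge_3 by simp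
  \<comment> \<open>The \<open>n\<close> vectors in the Jensen inequality are the outcomes of the
    \<open>n\<close> possible first edges for one fixed weight; their mean is the initial vector
    shifted by \<open>w / real n\<close>.\<close>
  have "of_nat n * G (\<lambda>_. x0) \<le> (\<Sum>i<n. G (average_step n (i, w) (\<lambda>_. x0)))" for w
    using G sum_step_const[OF n_ge_3] by (intro jensen_invariantD[where d = "w / real n"]) auto
  then have "(\<integral>\<^sup>+w. of_nat n * G (\<lambda>_. x0) \<partial>W) \<le> (\<integral>\<^sup>+w. (\<Sum>i<n. G (average_step n (i, w) (\<lambda>_. x0))) \<partial>W)"
    by (intro nn_integral_mono)
  then have "of_nat n * G (\<lambda>_. x0) \<le> (\<Sum>i<n. \<integral>\<^sup>+w. G (average_step n (i, w) (\<lambda>_. x0)) \<partial>W)"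
    by (simp add: nn_integral_sum emeasure_W_UNIV)
  then have "of_nat n * G (\<lambda>_. x0) / of_nat n \<le> trans_op G (\<lambda>_. x0)"
    unfolding trans_op_def by (rule divide_right_mono_ennreal)
  also have "of_nat n * G (\<lambda>_. x0) / of_nat n = G (\<lambda>_. x0)"
    using n0 by (simp add: mult_divide_eq_ennreal mult.commute[of "of_nat n"])
  finally show ?thesis using F(1) by (simp add: expect_eq_funpow G_def)
qed

end

section \<open>Inequalities between the gap and differences of loads\<close>

text \<open>The shift \<open>d\<close> cancels in the difference of two coordinates; the rest is
  Cauchy-Schwarz over \<open>n\<close> summands.\<close>

lemma jensen_square_diff:
  fixes y :: "nat \<Rightarrow> nat \<Rightarrow> real"
  assumes "n > 0" "(\<Sum>i<n. y i a) = real n * (x a + d)" "(\<Sum>i<n. y i b) = real n * (x b + d)"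
  shows "real n * (x a - x b)\<^sup>2 \<le> (\<Sum>i<n. (y i a - y i b)\<^sup>2)"
proof -
  have "(\<Sum>i<n. y i a - y i b) = real n * (x a - x b)"
    using assms by (simp add: sum_subtractf algebra_simps)
  then have "(real n * (x a - x b))\<^sup>2 \<le> (\<Sum>i<n. (y i a - y i b)\<^sup>2) * real n"
    using sum_squared_le_sum_of_squares[of "\<lambda>i. y i a - y i b" "{..<n}"] by simp
  then have "real n * (real n * (x a - x b)\<^sup>2) \<le> real n * (\<Sum>i<n. (y i a - y i b)\<^sup>2)"
    by (simp only: power_mult_distrib power2_eq_square[of "real n"] ac_simps)
  then show ?thesis using assms by simp
qed

lemma gap_attained:
  assumes "n > 0"
  obtains a b where "a < n" "b < n" "gap n x = x a - x b"
proof -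
  have "x ` {..<n} \<noteq> {}" "finite (x ` {..<n})" using assms by (auto simp: lessThan_empty_iff)
  then have "Max (x ` {..<n}) \<in> x ` {..<n}" "Min (x ` {..<n}) \<in> x ` {..<n}"
    by (auto intro: Max_in Min_in simp del: Max_in Min_in)
  then show thesis using that unfolding gap_def by auto
qed

lemma square_diff_le_gap:
  assumes "a < n" "b < n"
  shows "(x a - x b)\<^sup>2 \<le> (gap n x)\<^sup>2"
proof (rule abs_le_square_iff[THEN iffD1])
  have "x a \<le> Max (x ` {..<n})" "x b \<le> Max (x ` {..<n})"
    "Min (x ` {..<n}) \<le> x a" "Min (x ` {..<n}) \<le> x b"
    using assms by (auto intro!: Max_ge Min_le)
  then show "\<bar>x a - x b\<bar> \<le> \<bar>gap n x\<bar>" unfolding gap_def by linarith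
qed

lemma shift_dist_nonneg [simp]: "0 \<le> shift_dist n k x"
  by (simp add: shift_dist_def sum_nonneg)

lemma shift_dist_le_gap: "shift_dist n k x \<le> real n * (gap n x)\<^sup>2"
  using sum_bounded_above[of "{..<n}" "\<lambda>j. (x j - x ((j + k) mod n))\<^sup>2" "(gap n x)\<^sup>2"]
  by (simp add: shift_dist_def square_diff_le_gap)

text \<open>The extreme loads sit at some offset \<open>k\<close>, so their squared difference is
  one of the summands. This gives integrability of the squared gap and a bound uniform in
  time.\<close>

lemma gap_square_le:
  assumes "n > 0"
  shows "(gap n x)\<^sup>2 \<le> (\<Sum>k<n. shift_dist n k x)"
proof -
  obtain a b where ab: "a < n" "b < n" "gap n x = x a - x b" using gap_attained assms by blast
  define k where "k = (b + (n - a)) mod n"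
  have k: "k < n" using assms by (simp add: k_def)
  have "(a + k) mod n = (a + (b + (n - a))) mod n" unfolding k_def by (rule mod_add_right_eq)
  also have "a + (b + (n - a)) = b + n" using ab by simp
  finally have "(a + k) mod n = b" using ab by simp
  then have "(gap n x)\<^sup>2 = (x a - x ((a + k) mod n))\<^sup>2" by (simp add: ab)
  also have "\<dots> \<le> shift_dist n k x" unfolding shift_dist_def using ab
    by (intro member_le_sum) auto
  also have "\<dots> \<le> (\<Sum>k<n. shift_dist n k x)" using k by (intro member_le_sum) auto
  finally show ?thesis .
qed

section \<open>The second-difference system on the cycle\<close>

text \<open>By \<open>rec\<close>, consecutive differences grow by at least \<open>b\<close> per
  step, while by symmetry the last difference is the negative of the first. Hence
  \<open>(n - 3) b\<close> is at most minus twice the first difference, which \<open>one\<close>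
  bounds from below in terms of \<open>e 1\<close>.\<close>

lemma second_difference_bound:
  fixes e :: "nat \<Rightarrow> real" and v :: real
  assumes n: "n \<ge> 3" and sym: "e (n - 1) = e 1" "e (n - 2) = e 2"
    and one: "5 / 2 * e 1 \<le> e 2 + real n * v / 2"
    and rec: "\<And>k. 2 \<le> k \<Longrightarrow> k \<le> n - 2 \<Longrightarrow> 2 * e k + e 1 \<le> e (k - 1) + e (k + 1) + real n * v"
  shows "e 1 \<le> (real n - 2) * v"
proof -
  define b where "b = e 1 - real n * v"
  have "e (m + 2) - e (m + 1) \<ge> e 2 - e 1 + real m * b" if "m + 3 \<le> n" for m
    using that
  proof (induction m)
    case (Suc m)
    have "2 * e (m + 2) + e 1 \<le> e (m + 1) + e (m + 3) + real n * v"
      using rec[of "m + 2"] Suc.prems by (simp add: numeral_3_eq_3)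
    then show ?case using Suc by (simp add: b_def algebra_simps numeral_3_eq_3)
  qed (simp add: numeral_2_eq_2)
  \<comment> \<open>The instance \<open>m = n - 3\<close> compares the last difference with the
    first.\<close>
  moreover obtain m where "n = m + 3" using n by (metis add.commute le_Suc_ex)
  ultimately have "e (n - 1) - e (n - 2) \<ge> e 2 - e 1 + (real n - 3) * b"
    by (simp add: eval_nat_numeral)
  then have "e 1 - e 2 \<ge> e 2 - e 1 + (real n - 3) * b" using sym by simp
  moreover have "e 2 - e 1 \<ge> 3 / 2 * e 1 - real n * v / 2" using one by simp
  ultimately have "real n * e 1 \<le> real n * ((real n - 2) * v)"
    unfolding b_def by (simp add: algebra_simps)
  then show ?thesis using n by simp
qed

text \<open>With equalities the second difference is the constant \<open>b\<close>, so
  \<open>e\<close> is a quadratic polynomial; \<open>sym\<close> fixes its slope \<open>d\<close>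
  and \<open>one\<close> then fixes \<open>e 1\<close>.\<close>

lemma second_difference_solution:
  fixes e :: "nat \<Rightarrow> real" and v :: real
  assumes n: "n \<ge> 3" and sym: "e (n - 1) = e 1"
    and one: "5 / 2 * e 1 = e 2 + real n * v / 2"
    and rec: "\<And>k. 2 \<le> k \<Longrightarrow> k \<le> n - 2 \<Longrightarrow> 2 * e k + e 1 = e (k - 1) + e (k + 1) + real n * v"
    and k: "1 \<le> k" "k \<le> n - 1"
  shows "e k = v * (real k * (real n - real k) - 1)"
proof -
  define b where "b = e 1 - real n * v"
  define d where "d = e 2 - e 1"
  have sol: "e (m + 1) = e 1 + real m * d + b * real m * (real m - 1) / 2" if "m + 2 \<le> n" for m
    using that
  proof (induction m rule: less_induct)
    case (less m)
    consider "m = 0" | "m = 1" | l where "m = Suc (Suc l)" by (metis One_nat_def not0_implies_Suc)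
    then show ?case
    proof cases
      case 3
      have "2 * e (l + 2) + e 1 = e (l + 1) + e (l + 3) + real n * v"
        using rec[of "l + 2"] less.prems 3 by (simp add: numeral_3_eq_3)
      moreover have "e (l + 1) = e 1 + real l * d + b * real l * (real l - 1) / 2"
        using less.IH[of l] less.prems 3 by simp
      moreover have "e (l + 2) = e 1 + real (l + 1) * d + b * real (l + 1) * (real (l + 1) - 1) / 2"
        using less.IH[of "l + 1"] less.prems 3 by simp
      ultimately show ?thesis by (simp add: 3 b_def field_simps numeral_3_eq_3)
    qed (auto simp: d_def numeral_2_eq_2)
  qed
  \<comment> \<open>The quadratic at \<open>m = n - 2\<close>, that is at index
    \<open>n - 1\<close>, where \<open>sym\<close> makes the increment over \<open>e 1\<close>
    vanish; the factor \<open>n - 2\<close> is nonzero and cancels.\<close>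
  have "(real n - 2) * (d + b * (real n - 3) / 2) = 0"
    using sol[of "n - 2"] n sym by (simp add: of_nat_diff numeral_2_eq_2 Suc_diff_Suc field_simps)
  then have db: "d = - b * (real n - 3) / 2" using n by auto
  moreover have "d = 3 / 2 * e 1 - real n * v / 2" using one by (simp add: d_def)
  ultimately have "real n * e 1 = real n * ((real n - 2) * v)"
    unfolding b_def by (simp add: field_simps)
  then have e1: "e 1 = (real n - 2) * v" using n by simp
  then have "b = - 2 * v" by (simp add: b_def algebra_simps)
  moreover obtain m where m: "k = m + 1" using k by (metis add.commute le_Suc_ex)
  moreover have "m + 2 \<le> n" using m k n by simp
  ultimately show ?thesis using sol[of m] db e1
    by (simp add: field_simps)
qed

section \<open>Monotone expectations of the squared differences and of the squared gap\<close>

context cycle_averaging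
begin

lemma measurable_shift_dist [measurable]: "shift_dist n k \<in> borel_measurable load_space"
  unfolding shift_dist_def by measurable

lemma measurable_gap [measurable]: "gap n \<in> borel_measurable load_space"
  unfolding gap_def by measurable

lemma measurable_loads' [measurable]:
  "(\<lambda>\<omega>. loads n x0 \<omega> t) \<in> process_space n W \<rightarrow>\<^sub>M load_space"
  unfolding process_space_eq by (rule measurable_loads)

lemma jensen_invariant_shift_dist: "jensen_invariant (\<lambda>x. ennreal (shift_dist n k x))"
  unfolding jensen_invariant_def
proof (intro allI impI)
  fix x :: "nat \<Rightarrow> real" and y :: "nat \<Rightarrow> nat \<Rightarrow> real" and d :: real
  assume y: "\<forall>j<n. (\<Sum>i<n. y i j) = real n * (x j + d)"
  have n: "n > 0" using n_ge_3 by simp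
  have "real n * shift_dist n k x \<le> (\<Sum>j<n. \<Sum>i<n. (y i j - y i ((j + k) mod n))\<^sup>2)"
    unfolding shift_dist_def sum_distrib_left
    by (intro sum_mono jensen_square_diff[OF n]) (use y n in auto)
  also have "\<dots> = (\<Sum>i<n. shift_dist n k (y i))"
    unfolding shift_dist_def by (rule sum.swap)
  finally show "of_nat n * ennreal (shift_dist n k x) \<le> (\<Sum>i<n. ennreal (shift_dist n k (y i)))"
    by (simp add: sum_ennreal ennreal_of_nat_eq_real_of_nat ennreal_mult'[symmetric] ennreal_leI)
qed

lemma jensen_invariant_gap: "jensen_invariant (\<lambda>x. ennreal ((gap n x)\<^sup>2))"
  unfolding jensen_invariant_def
proof (intro allI impI)
  fix x :: "nat \<Rightarrow> real" and y :: "nat \<Rightarrow> nat \<Rightarrow> real" and d :: real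
  assume y: "\<forall>j<n. (\<Sum>i<n. y i j) = real n * (x j + d)"
  have n: "n > 0" using n_ge_3 by simp
  obtain a b where ab: "a < n" "b < n" "gap n x = x a - x b" using gap_attained n by blast
  have "real n * (gap n x)\<^sup>2 \<le> (\<Sum>i<n. (y i a - y i b)\<^sup>2)"
    unfolding ab(3) using y ab n by (intro jensen_square_diff) auto
  also have "\<dots> \<le> (\<Sum>i<n. (gap n (y i))\<^sup>2)"
    by (intro sum_mono square_diff_le_gap ab)
  finally show "of_nat n * ennreal ((gap n x)\<^sup>2) \<le> (\<Sum>i<n. ennreal ((gap n (y i))\<^sup>2))"
    by (simp add: sum_ennreal ennreal_of_nat_eq_real_of_nat ennreal_mult'[symmetric] ennreal_leI)
qed

lemma integral_mono_Suc:
  fixes G :: "(nat \<Rightarrow> real) \<Rightarrow> real"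
  assumes [measurable]: "G \<in> borel_measurable load_space" and "\<And>x. 0 \<le> G x"
    and "jensen_invariant (\<lambda>x. ennreal (G x))"
    and "\<And>t. integrable (process_space n W) (\<lambda>\<omega>. G (loads n x0 \<omega> t))"
  shows "incseq (\<lambda>t. \<integral>\<omega>. G (loads n x0 \<omega> t) \<partial>process_space n W)"
proof (rule incseq_SucI)
  fix t
  have "expect x0 t (\<lambda>x. ennreal (G x)) \<le> expect x0 (Suc t) (\<lambda>x. ennreal (G x))"
    by (rule expect_mono_Suc) (use assms in auto)
  moreover have "expect x0 t (\<lambda>x. ennreal (G x)) = ennreal (\<integral>\<omega>. G (loads n x0 \<omega> t) \<partial>process_space n W)" for t
    unfolding expect_def by (rule nn_integral_eq_integral[OF assms(4)]) (simp add: assms(2))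
  ultimately show "(\<integral>\<omega>. G (loads n x0 \<omega> t) \<partial>process_space n W) \<le> (\<integral>\<omega>. G (loads n x0 \<omega> (Suc t)) \<partial>process_space n W)"
    using Bochner_Integration.integral_nonneg[of "process_space n W" "\<lambda>\<omega>. G (loads n x0 \<omega> (Suc t))"] assms(2)
    by (simp only: ennreal_le_iff)
qed

end

section \<open>Recurrences and limits of the mean squared differences\<close>

locale cycle_averaging_L2 = cycle_averaging +
  assumes square_integrable: "integrable W (\<lambda>w. w\<^sup>2)"
begin

definition second_moment where "second_moment = (\<integral>w. w\<^sup>2 \<partial>W)"

lemma second_moment_nonneg: "0 \<le> second_moment" by (simp add: second_moment_def)

text \<open>As all terms are nonnegative, the one-step identity can be integrated in
  \<open>ennreal\<close> with no prior knowledge about \<open>G\<close> at time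
  \<open>Suc t\<close>. Finiteness of the right-hand side then yields integrability of
  \<open>G\<close>, and the identity can be read off in the reals.\<close>

lemma integral_step:
  fixes G H K :: "(nat \<Rightarrow> real) \<Rightarrow> real"
  assumes [measurable]: "G \<in> borel_measurable load_space" "H \<in> borel_measurable load_space"
      "K \<in> borel_measurable load_space"
    and nonneg: "\<And>x. 0 \<le> G x" "\<And>x. 0 \<le> H x" "\<And>x. 0 \<le> K x" "0 \<le> c"
    and eq: "\<And>w x. (\<Sum>i<n. G (average_step n (i, w) x)) + H x = K x + c * w\<^sup>2"
    and int: "integrable (process_space n W) (\<lambda>\<omega>. H (loads n x0 \<omega> t))"
      "integrable (process_space n W) (\<lambda>\<omega>. K (loads n x0 \<omega> t))"
  shows "integrable (process_space n W) (\<lambda>\<omega>. G (loads n x0 \<omega> (Suc t)))" (is ?A)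
    and "real n * (\<integral>\<omega>. G (loads n x0 \<omega> (Suc t)) \<partial>process_space n W)
        + (\<integral>\<omega>. H (loads n x0 \<omega> t) \<partial>process_space n W)
      = (\<integral>\<omega>. K (loads n x0 \<omega> t) \<partial>process_space n W) + c * second_moment" (is ?B)
proof -
  interpret P: prob_space "process_space n W"
    unfolding process_space_eq by (rule S.P.prob_space_axioms)
  have n0: "of_nat n \<noteq> (0::ennreal)" "of_nat n \<noteq> (\<top>::ennreal)" using n_ge_3 by auto
  have sec[measurable]: "(\<lambda>w. ennreal (G (average_step n (i, w) x))) \<in> borel_measurable W" for i x
    by (rule measurable_section) measurable
  have measurable_G: "(\<lambda>x. ennreal (G x)) \<in> borel_measurable load_space"
    by measurable
  have nn_moment: "(\<integral>\<^sup>+w. ennreal (w\<^sup>2) \<partial>W) = ennreal second_moment"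
    unfolding second_moment_def by (rule nn_integral_eq_integral[OF square_integrable]) simp
  have "of_nat n * trans_op (\<lambda>x. ennreal (G x)) x + ennreal (H x) = ennreal (K x) + ennreal (c * second_moment)" for x
  proof -
    have "of_nat n * trans_op (\<lambda>x. ennreal (G x)) x = (\<Sum>i<n. \<integral>\<^sup>+w. ennreal (G (average_step n (i, w) x)) \<partial>W)"
      unfolding trans_op_def using n0 by (simp add: ennreal_times_divide mult_divide_eq_ennreal mult.commute[of "of_nat n"])
    also have "\<dots> + ennreal (H x) = (\<integral>\<^sup>+w. (\<Sum>i<n. ennreal (G (average_step n (i, w) x))) + ennreal (H x) \<partial>W)"
      by (simp add: nn_integral_add nn_integral_sum emeasure_W_UNIV)
    also have "\<dots> = (\<integral>\<^sup>+w. ennreal (K x) + ennreal c * ennreal (w\<^sup>2) \<partial>W)"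
      using eq[symmetric] nonneg
      by (intro nn_integral_cong) (simp add: sum_ennreal ennreal_plus[symmetric] ennreal_mult[symmetric] sum_nonneg del: ennreal_plus)
    also have "\<dots> = ennreal (K x) + ennreal (c * second_moment)"
      using nonneg second_moment_nonneg by (simp add: nn_integral_add nn_integral_cmult emeasure_W_UNIV nn_moment ennreal_mult)
    finally show ?thesis .
  qed
  then have "(\<integral>\<^sup>+\<omega>. of_nat n * trans_op (\<lambda>x. ennreal (G x)) (loads n x0 \<omega> t) + ennreal (H (loads n x0 \<omega> t)) \<partial>process_space n W)
      = (\<integral>\<^sup>+\<omega>. ennreal (K (loads n x0 \<omega> t)) + ennreal (c * second_moment) \<partial>process_space n W)"
    by simp
  then have "of_nat n * expect x0 t (trans_op (\<lambda>x. ennreal (G x))) + (\<integral>\<^sup>+\<omega>. ennreal (H (loads n x0 \<omega> t)) \<partial>process_space n W)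
      = (\<integral>\<^sup>+\<omega>. ennreal (K (loads n x0 \<omega> t)) \<partial>process_space n W) + ennreal (c * second_moment)"
    unfolding expect_def
    by (simp add: nn_integral_add nn_integral_cmult P.emeasure_space_1)
  then have *: "of_nat n * (\<integral>\<^sup>+\<omega>. ennreal (G (loads n x0 \<omega> (Suc t))) \<partial>process_space n W)
      + ennreal (\<integral>\<omega>. H (loads n x0 \<omega> t) \<partial>process_space n W)
      = ennreal ((\<integral>\<omega>. K (loads n x0 \<omega> t) \<partial>process_space n W) + c * second_moment)"
    using nonneg second_moment_nonneg
    unfolding expect_Suc[OF measurable_G, symmetric] nn_integral_eq_integral[OF int(1) AE_I2[OF nonneg(2)]]
      nn_integral_eq_integral[OF int(2) AE_I2[OF nonneg(3)]]
    by (simp add: expect_def ennreal_plus integral_nonneg_AE del: loads.simps)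
  \<comment> \<open>The \<open>G\<close> term is one of two nonnegative summands of a finite
    quantity.\<close>
  have "of_nat n * (\<integral>\<^sup>+\<omega>. ennreal (G (loads n x0 \<omega> (Suc t))) \<partial>process_space n W) < \<top>"
    by (rule le_less_trans[of _ "ennreal ((\<integral>\<omega>. K (loads n x0 \<omega> t) \<partial>process_space n W) + c * second_moment)"])
      (simp only: *[symmetric] le_add_same_cancel1 add_increasing2 order_refl zero_le, rule ennreal_less_top)
  then have "(\<integral>\<^sup>+\<omega>. ennreal (G (loads n x0 \<omega> (Suc t))) \<partial>process_space n W) < \<top>"
    using n0 by (auto simp: ennreal_mult_less_top simp del: loads.simps)
  then show A: ?A
    using nonneg by (intro integrableI_nonneg) (auto simp del: loads.simps)
  have "ennreal (real n * (\<integral>\<omega>. G (loads n x0 \<omega> (Suc t)) \<partial>process_space n W)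
      + (\<integral>\<omega>. H (loads n x0 \<omega> t) \<partial>process_space n W))
      = ennreal ((\<integral>\<omega>. K (loads n x0 \<omega> t) \<partial>process_space n W) + c * second_moment)"
    unfolding *[symmetric] using A nonneg
    by (subst nn_integral_eq_integral[OF A AE_I2[OF nonneg(1)]])
      (simp add: ennreal_plus ennreal_mult ennreal_of_nat_eq_real_of_nat integral_nonneg_AE del: loads.simps)
  then show ?B
    using nonneg second_moment_nonneg by (subst (asm) ennreal_inj) (simp_all add: integral_nonneg_AE del: loads.simps)
qed

text \<open>Only the identity for offset 1 drives the induction. Every offset, also outside the
  range of \<open>sum_step_shift_dist\<close>, is then dominated through
  \<open>shift_dist_le\<close>.\<close>

lemma integrable_shift_dist:
  "integrable (process_space n W) (\<lambda>\<omega>. shift_dist n k (loads n x0 \<omega> t))"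
proof (induction t arbitrary: k)
  case 0
  then show ?case by (simp add: shift_dist_def)
next
  case (Suc t)
  have "integrable (process_space n W) (\<lambda>\<omega>. shift_dist n 1 (loads n x0 \<omega> (Suc t)))"
    by (rule integral_step(1)[where H = "\<lambda>x. 5 / 2 * shift_dist n 1 x" and
          K = "\<lambda>x. real n * shift_dist n 1 x + shift_dist n 2 x" and c = "real n / 2"])
      (use Suc sum_step_shift_dist_1[OF n_ge_3] in auto)
  then have "integrable (process_space n W) (\<lambda>\<omega>. 4 ^ k * shift_dist n 1 (loads n x0 \<omega> (Suc t)))"
    by (rule integrable_mult_right)
  then show ?case
    by (rule Bochner_Integration.integrable_bound)
      (auto simp: shift_dist_le[OF n_ge_3] simp del: loads.simps One_nat_def)
qed

definition mean_dist :: "real \<Rightarrow> nat \<Rightarrow> nat \<Rightarrow> real" where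
  "mean_dist x0 k t = (\<integral>\<omega>. shift_dist n k (loads n x0 \<omega> t) \<partial>process_space n W)"

lemma mean_dist_1:
  "real n * mean_dist x0 1 (Suc t) + 5 / 2 * mean_dist x0 1 t =
     real n * mean_dist x0 1 t + mean_dist x0 2 t + real n / 2 * second_moment"
  using integral_step(2)[where G = "shift_dist n 1" and H = "\<lambda>x. 5 / 2 * shift_dist n 1 x" and
          K = "\<lambda>x. real n * shift_dist n 1 x + shift_dist n 2 x" and c = "real n / 2" and t = t and ?x0.0 = x0]
    sum_step_shift_dist_1[OF n_ge_3] integrable_shift_dist
  by (simp add: mean_dist_def del: loads.simps One_nat_def)

lemma mean_dist_rec:
  assumes "2 \<le> k" "k \<le> n - 2"
  shows "real n * mean_dist x0 k (Suc t) + mean_dist x0 1 t =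
     (real n - 2) * mean_dist x0 k t + mean_dist x0 (k - 1) t + mean_dist x0 (k + 1) t + real n * second_moment"
  using integral_step(2)[where G = "shift_dist n k" and H = "shift_dist n 1" and
          K = "\<lambda>x. (real n - 2) * shift_dist n k x + shift_dist n (k - 1) x + shift_dist n (k + 1) x"
          and c = "real n" and t = t and ?x0.0 = x0]
    sum_step_shift_dist[OF n_ge_3 assms] integrable_shift_dist n_ge_3
  by (simp add: mean_dist_def del: loads.simps One_nat_def)

lemma incseq_mean_dist: "incseq (mean_dist x0 k)"
  unfolding mean_dist_def
  by (rule integral_mono_Suc) (auto intro: jensen_invariant_shift_dist integrable_shift_dist)

lemma mean_dist_reflect: "k \<le> n \<Longrightarrow> mean_dist x0 (n - k) t = mean_dist x0 k t"
  by (simp add: mean_dist_def shift_dist_reflect[OF n_ge_3])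

text \<open>At each fixed time, monotonicity makes the increments in both recurrences nonnegative;
  what remains are the hypotheses of \<open>second_difference_bound\<close>.\<close>

lemma mean_dist_1_le: "mean_dist x0 1 t \<le> (real n - 2) * second_moment"
proof (rule second_difference_bound[OF n_ge_3])
  have mono: "real n * mean_dist x0 k t \<le> real n * mean_dist x0 k (Suc t)" for k
    by (intro mult_left_mono incseq_SucD incseq_mean_dist) auto
  show "5 / 2 * mean_dist x0 1 t \<le> mean_dist x0 2 t + real n * second_moment / 2"
    using mono[of 1] mean_dist_1[of x0 t] by simp
  show "2 * mean_dist x0 k t + mean_dist x0 1 t \<le>
      mean_dist x0 (k - 1) t + mean_dist x0 (k + 1) t + real n * second_moment" if "2 \<le> k" "k \<le> n - 2" for k
    using mono[of k] mean_dist_rec[OF that, of x0 t] by (simp add: algebra_simps)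
qed (use mean_dist_reflect n_ge_3 in auto)

lemma mean_dist_le: "mean_dist x0 k t \<le> 4 ^ k * ((real n - 2) * second_moment)"
proof -
  have "mean_dist x0 k t \<le> (\<integral>\<omega>. 4 ^ k * shift_dist n 1 (loads n x0 \<omega> t) \<partial>process_space n W)"
    unfolding mean_dist_def
    by (intro integral_mono integrable_mult_right integrable_shift_dist shift_dist_le n_ge_3)
  also have "\<dots> = 4 ^ k * mean_dist x0 1 t" by (simp add: mean_dist_def)
  also have "\<dots> \<le> 4 ^ k * ((real n - 2) * second_moment)" by (intro mult_left_mono mean_dist_1_le) simp
  finally show ?thesis .
qed

text \<open>Monotone bounded sequences converge, and in the limit of the recurrences the increments
  cancel. The limits thus satisfy the stationary system, whose only solution is the stated
  one.\<close>

lemma mean_dist_limit: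
  assumes k: "1 \<le> k" "k \<le> n - 1"
  shows "mean_dist x0 k \<longlonglongrightarrow> second_moment * (real k * (real n - real k) - 1)"
proof -
  define s where "s k = (SUP t. mean_dist x0 k t)" for k
  have lim: "mean_dist x0 k \<longlonglongrightarrow> s k" for k
    unfolding s_def
    by (intro LIMSEQ_incseq_SUP incseq_mean_dist bdd_aboveI2[of _ _ "4 ^ k * ((real n - 2) * second_moment)"] mean_dist_le)
  have lim': "(\<lambda>t. mean_dist x0 k (Suc t)) \<longlonglongrightarrow> s k" for k
    by (rule LIMSEQ_Suc[OF lim])
  have "s k = second_moment * (real k * (real n - real k) - 1)"
  proof (rule second_difference_solution[OF n_ge_3 _ _ _ k])
    show "s (n - 1) = s 1"
      unfolding s_def using mean_dist_reflect[of 1] n_ge_3 by simp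
    have "(\<lambda>t. real n * mean_dist x0 1 (Suc t) + 5 / 2 * mean_dist x0 1 t) \<longlonglongrightarrow> real n * s 1 + 5 / 2 * s 1"
      by (intro tendsto_intros lim lim')
    moreover have "(\<lambda>t. real n * mean_dist x0 1 (Suc t) + 5 / 2 * mean_dist x0 1 t) \<longlonglongrightarrow>
        real n * s 1 + s 2 + real n / 2 * second_moment"
      unfolding mean_dist_1 by (intro tendsto_intros lim)
    ultimately show "5 / 2 * s 1 = s 2 + real n * second_moment / 2"
      using LIMSEQ_unique by fastforce
    fix k assume k: "2 \<le> k" "k \<le> n - 2"
    have "(\<lambda>t. real n * mean_dist x0 k (Suc t) + mean_dist x0 1 t) \<longlonglongrightarrow> real n * s k + s 1"
      by (intro tendsto_intros lim lim')
    moreover have "(\<lambda>t. real n * mean_dist x0 k (Suc t) + mean_dist x0 1 t) \<longlonglongrightarrow>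
        (real n - 2) * s k + s (k - 1) + s (k + 1) + real n * second_moment"
      unfolding mean_dist_rec[OF k] by (intro tendsto_intros lim)
    ultimately have "real n * s k + s 1 = (real n - 2) * s k + s (k - 1) + s (k + 1) + real n * second_moment"
      by (rule LIMSEQ_unique)
    then show "2 * s k + s 1 = s (k - 1) + s (k + 1) + real n * second_moment"
      by (simp add: algebra_simps)
  qed
  then show ?thesis using lim[of k] by simp
qed

section \<open>The limit of the expected squared gap\<close>

lemma integrable_gap: "integrable (process_space n W) (\<lambda>\<omega>. (gap n (loads n x0 \<omega> t))\<^sup>2)"
proof (rule Bochner_Integration.integrable_bound)
  show "integrable (process_space n W) (\<lambda>\<omega>. \<Sum>k<n. shift_dist n k (loads n x0 \<omega> t))"
    by (intro Bochner_Integration.integrable_sum integrable_shift_dist)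
  show "AE \<omega> in process_space n W. norm ((gap n (loads n x0 \<omega> t))\<^sup>2)
      \<le> norm (\<Sum>k<n. shift_dist n k (loads n x0 \<omega> t))"
    using gap_square_le n_ge_3 by (auto simp: sum_nonneg)
qed measurable

lemma gap_limit:
  obtains L where "(\<lambda>t. \<integral>\<omega>. (gap n (loads n x0 \<omega> t))\<^sup>2 \<partial>process_space n W) \<longlonglongrightarrow> L"
    and "L \<ge> 1 / 9 * real n * second_moment"
proof -
  let ?g = "\<lambda>t. \<integral>\<omega>. (gap n (loads n x0 \<omega> t))\<^sup>2 \<partial>process_space n W"
  have inc: "incseq ?g"
    by (rule integral_mono_Suc) (auto intro: jensen_invariant_gap integrable_gap)
  \<comment> \<open>Convergence of the increasing sequence only asks for a bound independent of
    \<open>t\<close>; its exponential size in \<open>n\<close> does no harm.\<close>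
  have "?g t \<le> (\<Sum>k<n. 4 ^ k * ((real n - 2) * second_moment))" for t
  proof -
    have "?g t \<le> (\<integral>\<omega>. (\<Sum>k<n. shift_dist n k (loads n x0 \<omega> t)) \<partial>process_space n W)"
      using n_ge_3
      by (intro integral_mono integrable_gap Bochner_Integration.integrable_sum integrable_shift_dist gap_square_le) auto
    also have "\<dots> = (\<Sum>k<n. mean_dist x0 k t)"
      by (simp add: mean_dist_def integrable_shift_dist)
    also have "\<dots> \<le> (\<Sum>k<n. 4 ^ k * ((real n - 2) * second_moment))"
      by (intro sum_mono mean_dist_le)
    finally show ?thesis .
  qed
  then obtain L where L: "?g \<longlonglongrightarrow> L"
    using incseq_convergent[OF inc] by blast
  \<comment> \<open>The nearly antipodal offset maximises \<open>k (n - k)\<close>, which is then of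
    order \<open>n\<^sup>2\<close>; the factor \<open>n\<close> from
    \<open>shift_dist_le_gap\<close> leaves order \<open>n\<close> for the gap.\<close>
  define k where "k = n div 2"
  have "mean_dist x0 k t \<le> real n * ?g t" for t
  proof -
    have "mean_dist x0 k t \<le> (\<integral>\<omega>. real n * (gap n (loads n x0 \<omega> t))\<^sup>2 \<partial>process_space n W)"
      unfolding mean_dist_def
      by (intro integral_mono integrable_mult_right integrable_gap integrable_shift_dist shift_dist_le_gap)
    then show ?thesis by simp
  qed
  moreover have "mean_dist x0 k \<longlonglongrightarrow> second_moment * (real k * (real n - real k) - 1)"
    using n_ge_3 by (intro mean_dist_limit) (auto simp: k_def)
  ultimately have "second_moment * (real k * (real n - real k) - 1) \<le> real n * L"
    by (intro LIMSEQ_le[OF _ tendsto_mult_left[OF L]]) auto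
  \<comment> \<open>The origin of the constant: \<open>k (n - k) - 1\<close> is at least
    \<open>(n\<^sup>2 - 5) / 4\<close>, and this is at least \<open>n\<^sup>2 / 9\<close> exactly
    when \<open>n\<^sup>2\<close> is at least 9, with equality at \<open>n = 3\<close>.\<close>
  moreover have "real n * (1 / 9 * real n) \<le> real k * (real n - real k) - 1"
  proof -
    have "real n = 2 * real k \<or> real n = 2 * real k + 1"
      unfolding k_def by (cases "even n") (auto elim!: evenE oddE)
    then have "real k * (real n - real k) \<ge> (real n * real n - 1) / 4"
      by (elim disjE) (simp_all add: field_simps)
    moreover have "real n * real n \<ge> 9"
      using mult_mono[of 3 "real n" 3 "real n"] n_ge_3 by simp
    ultimately show ?thesis by simp
  qed
  ultimately have "real n * (1 / 9 * real n * second_moment) \<le> real n * L"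
    using mult_left_mono[OF _ second_moment_nonneg, of "real n * (1 / 9 * real n)"]
    by (smt (verit, best) mult.assoc mult.commute)
  then have "L \<ge> 1 / 9 * real n * second_moment" using n_ge_3 by simp
  with L that show thesis by blast
qed

end

theorem theorem2:
  "\<exists>c::real. c > 0 \<and>
     (\<forall>(n::nat) (W::real measure) (x0::real).
        n \<ge> 3 \<longrightarrow> real_distribution W \<longrightarrow> integrable W (\<lambda>w. w\<^sup>2) \<longrightarrow>
        (\<exists>L::real.
           (\<lambda>t. \<integral>\<omega>. (gap n (loads n x0 \<omega> t))\<^sup>2 \<partial>process_space n W) \<longlonglongrightarrow> L \<and>
           L \<ge> c * real n * (\<integral>w. w\<^sup>2 \<partial>W)))"
proof (rule exI[of _ "1 / 9"], intro conjI allI impI)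
  fix n :: nat and W :: "real measure" and x0 :: real
  assume *: "n \<ge> 3" "real_distribution W" "integrable W (\<lambda>w. w\<^sup>2)"
  interpret W: real_distribution W by fact
  interpret cycle_averaging_L2 W n by unfold_locales (use * in auto)
  show "\<exists>L. (\<lambda>t. \<integral>\<omega>. (gap n (loads n x0 \<omega> t))\<^sup>2 \<partial>process_space n W) \<longlonglongrightarrow> L \<and>
      L \<ge> 1 / 9 * real n * (\<integral>w. w\<^sup>2 \<partial>W)"
    using gap_limit[of x0] unfolding second_moment_def by blast
qed simp

end
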